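(* (i) For every natural number $n\ge1$ and every nonzero point $(\zeta,\xi)$, $$\Psi(\zeta,\xi,n)=\frac{\Omega_0(\lfloor n/2\rfloor\,|\,\zeta,\xi\,|\,n)}{(n-1)(n-2)\cdots(n-\lfloor n/2\rfloor)} .$$ (ii) For every natural number $n\ge1$, the $\Omega$ sequence satisfies the identity in $x,y$ $$\frac{x^n+y^n}{(x+y)^{\delta(n)}}=\frac{\Omega_0(\lfloor n/2\rfloor\,|\,xy,-x^2-y^2\,|\,n)}{(n-1)(n-2)\cdots(n-\lfloor n/2\rfloor)} .$$ (iii) For all natural numbers $n\ge 1$ and $k$, every nonzero point $(\alpha,\beta)$ and variables $a,b$, $$\frac{(-1)^k}{k!}\Big(\alpha\frac{\partial}{\partial a}+\beta\frac{\partial}{\partial b}\Big)^{k}\Psi(a,b,n)=\sum_{r=0}^{\lfloor n/2\rfloor-k}(-1)^{r+k}\,\frac{(n-r-k-1)!\;n}{(n-2r)!\;r!}\binom{\lfloor n/2\rfloor-r}{k}\,\Omega_r(k|\alpha,\beta|n)\;a^{r}\,(2a-b)^{\lfloor n/2\rfloor-k-r},$$ where the sum is empty (zero) if $k>\lfloor n/2\rfloor$. (iv) For every nonzero point $(\alpha,\beta)$ and every $k>1$, $$p_{k+1}\;\Big|\;\Omega_0(p_k\,|\,\alpha,\beta\,|\,2p_k),$$ where $p_k$ denotes the $k$-th prime.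
   Context: Points have real coordinates, and a point is nonzero if it differs from $(0,0)$. For a natural number $m$, $\delta(m)\in\{0,1\}$ denotes $m\bmod 2$. Empty products equal $1$. The primes are indexed as $p_1=2,\ p_2=3,\ p_3=5,\dots$ The sequence $\Psi(a,b,n)=\Psi(n)$ is defined by $\Psi(0)=2$, $\Psi(1)=1$, $\Psi(n+1)=(2a-b)^{\delta(n)}\Psi(n)-a\,\Psi(n-1)$ for $n\ge1$; it is a polynomial in $a,b$. The Quanta Prime Sequence $\Omega_r(k|\zeta,\xi|n)$ associated with $n$ and a point $(\zeta,\xi)\ne(0,0)$ is defined for integers $r,k\ge0$ with $r+k\le\lfloor n/2\rfloor$ by $\Omega_r(0|\zeta,\xi|n)=1$ for all $r$, and for $k\ge1$ $$\Omega_r(k|\zeta,\xi|n)=(2\zeta-\xi)(n-r-k)\,\Omega_r(k-1|\zeta,\xi|n)-2\zeta\,(n-2r-\delta(n-1))\,\Omega_{r+1}(k-1|\zeta,\xi|n).$$ *)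

theory Defs
  imports "HOL-Analysis.Analysis" "HOL-Computational_Algebra.Primes" "HOL-Library.Infinite_Set"
begin

definition delta :: "nat \<Rightarrow> nat" where
  "delta m = m mod 2"

fun Psi :: "real \<Rightarrow> real \<Rightarrow> nat \<Rightarrow> real" where
  "Psi a b 0 = 2"
| "Psi a b (Suc 0) = 1"
| "Psi a b (Suc (Suc n)) = (2 * a - b) ^ delta (Suc n) * Psi a b (Suc n) - a * Psi a b n"

text \<open>\<open>Omega r k \<zeta> \<xi> n\<close> is \<open>\<Omega>\<^sub>r(k|\<zeta>,\<xi>|n)\<close>. The sequence is meant for
  \<open>r + k \<le> n div 2\<close> and a nonzero point; outside this range the same recursion merely
  supplies a value. Differences are taken in the reals, except in \<open>n - 1\<close>, where
  \<open>n \<ge> 2\<close> on the intended range since \<open>k \<ge> 1\<close> there.\<close>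

fun Omega :: "nat \<Rightarrow> nat \<Rightarrow> real \<Rightarrow> real \<Rightarrow> nat \<Rightarrow> real" where
  "Omega r 0 \<zeta> \<xi> n = 1"
| "Omega r (Suc k) \<zeta> \<xi> n =
     (2 * \<zeta> - \<xi>) * (real n - real r - real (Suc k)) * Omega r k \<zeta> \<xi> n
     - 2 * \<zeta> * (real n - 2 * real r - real (delta (n - 1))) * Omega (Suc r) k \<zeta> \<xi> n"

text \<open>The operator \<open>\<alpha> \<partial>/\<partial>a + \<beta> \<partial>/\<partial>b\<close>. It is applied only to polynomial functions, for
  which both partial derivatives exist everywhere.\<close>

definition dir_op :: "real \<Rightarrow> real \<Rightarrow> (real \<Rightarrow> real \<Rightarrow> real) \<Rightarrow> real \<Rightarrow> real \<Rightarrow> real" where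
  "dir_op \<alpha> \<beta> F = (\<lambda>a b. \<alpha> * deriv (\<lambda>t. F t b) a + \<beta> * deriv (\<lambda>t. F a t) b)"

text \<open>Primes are indexed from 1 (\<open>nth_prime 1 = 2\<close>), whereas \<open>enumerate\<close> counts from 0.\<close>

definition nth_prime :: "nat \<Rightarrow> nat" where
  "nth_prime k = enumerate {p. prime p} (k - 1)"

text \<open>Divisibility by an integer of a polynomial expression with integer coefficients in real
  numbers \<open>\<alpha>\<close>, \<open>\<beta>\<close> is understood in the ring \<open>\<int>[\<alpha>,\<beta>]\<close>, since
  divisibility by a nonzero number in the field of reals would be vacuous. For integers \<open>\<alpha>\<close>, \<open>\<beta>\<close> this is ordinary
  divisibility of integers (lemma \<open>dvd_in_int_adjoin_of_int\<close>), and for algebraically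
  independent \<open>\<alpha>\<close>, \<open>\<beta>\<close> it is divisibility of polynomials with integer coefficients.\<close>

inductive_set int_adjoin :: "real \<Rightarrow> real \<Rightarrow> real set" for \<alpha> \<beta> :: real where
  one: "1 \<in> int_adjoin \<alpha> \<beta>"
| gen1: "\<alpha> \<in> int_adjoin \<alpha> \<beta>"
| gen2: "\<beta> \<in> int_adjoin \<alpha> \<beta>"
| diff: "x \<in> int_adjoin \<alpha> \<beta> \<Longrightarrow> y \<in> int_adjoin \<alpha> \<beta> \<Longrightarrow> x - y \<in> int_adjoin \<alpha> \<beta>"
| mult: "x \<in> int_adjoin \<alpha> \<beta> \<Longrightarrow> y \<in> int_adjoin \<alpha> \<beta> \<Longrightarrow> x * y \<in> int_adjoin \<alpha> \<beta>"

definition dvd_in :: "real set \<Rightarrow> real \<Rightarrow> real \<Rightarrow> bool" where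
  "dvd_in R d x \<longleftrightarrow> (\<exists>q\<in>R. x = d * q)"

lemma of_int_in_int_adjoin: "real_of_int z \<in> int_adjoin \<alpha> \<beta>"
proof (induction z rule: int_induct[where k = 0])
  case base
  have "(1::real) - 1 \<in> int_adjoin \<alpha> \<beta>"
    by (intro int_adjoin.diff int_adjoin.one)
  then show ?case by simp
next
  case (step1 i)
  have "real_of_int i - (1 - 1 - 1) \<in> int_adjoin \<alpha> \<beta>"
    by (intro int_adjoin.diff int_adjoin.one step1)
  then show ?case by simp
next
  case (step2 i)
  have "real_of_int i - 1 \<in> int_adjoin \<alpha> \<beta>"
    by (intro int_adjoin.diff int_adjoin.one step2)
  then show ?case by simp
qed

lemma int_adjoin_of_int: "int_adjoin (of_int u) (of_int v) = \<int>"
proof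
  show "int_adjoin (of_int u) (of_int v) \<subseteq> \<int>"
  proof
    fix x assume "x \<in> int_adjoin (of_int u) (of_int v)"
    then show "x \<in> \<int>" by induction auto
  qed
  show "\<int> \<subseteq> int_adjoin (of_int u) (of_int v)"
    by (auto elim!: Ints_cases intro: of_int_in_int_adjoin)
qed

lemma dvd_in_int_adjoin_of_int:
  "dvd_in (int_adjoin (of_int u) (of_int v)) (of_int d) (of_int z) \<longleftrightarrow> d dvd z"
proof
  assume "dvd_in (int_adjoin (of_int u) (of_int v)) (of_int d) (of_int z)"
  then obtain q where "real_of_int z = of_int d * of_int q"
    by (auto simp: dvd_in_def int_adjoin_of_int elim!: Ints_cases)
  then have "z = d * q" by (metis of_int_eq_iff of_int_mult)
  then show "d dvd z" by simp
next
  assume "d dvd z"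
  then obtain q where "z = d * q" by (auto elim: dvdE)
  then show "dvd_in (int_adjoin (of_int u) (of_int v)) (of_int d) (of_int z)"
    by (auto simp: dvd_in_def int_adjoin_of_int)
qed

end

theory Submission
  imports Defs
begin

text \<open>With \<open>w = 2a - b\<close>, the polynomial \<open>\<Psi>(a,b,n)\<close> is homogeneous of degree
  \<open>\<lfloor>n/2\<rfloor>\<close> in \<open>a\<close> and \<open>w\<close>, and its coefficients are the case \<open>k = 0\<close> of (iii). Since
  \<open>\<alpha> \<partial>/\<partial>a + \<beta> \<partial>/\<partial>b\<close> maps \<open>a\<close> to \<open>\<alpha>\<close> and \<open>w\<close> to \<open>2\<alpha> - \<beta>\<close>, comparing coefficients in (iii)
  for \<open>k\<close> and \<open>k + 1\<close> yields exactly the recursion that defines \<open>\<Omega>\<close>. For \<open>k = \<lfloor>n/2\<rfloor>\<close> the right-hand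
  side of (iii) is a multiple of \<open>\<Omega>\<^sub>0\<close>, while Euler's identity at \<open>(a,b) = (\<alpha>,\<beta>)\<close> turns the
  left-hand side into \<open>\<plusminus>\<Psi>(\<alpha>,\<beta>,n)\<close>; this is (i). Part (ii) follows because for \<open>a = xy\<close> and
  \<open>b = -x\<^sup>2 - y\<^sup>2\<close> one has \<open>w = (x + y)\<^sup>2\<close>. By (i), \<open>\<Omega>\<^sub>0(p|\<alpha>,\<beta>|2p)\<close> is
  \<open>\<Psi>(\<alpha>,\<beta>,2p)\<close> times the product of the integers from \<open>p\<close> to \<open>2p - 1\<close>, among which Bertrand's
  postulate finds the prime following \<open>p\<close>; this is (iv).\<close>

section \<open>Directional derivatives of \<open>\<Psi>\<close>\<close>


text \<open>\<open>w\<close> is kept as an independent variable, and \<open>2 * a - b\<close> is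
  substituted only when differentiating or evaluating.\<close>

definition hom_poly :: "(nat \<Rightarrow> real) \<Rightarrow> nat \<Rightarrow> real \<Rightarrow> real \<Rightarrow> real" where
  "hom_poly c N a w = (\<Sum>r\<le>N. c r * a ^ r * w ^ (N - r))"

lemma hom_poly_cong:
  "(\<And>r. r \<le> N \<Longrightarrow> c r = d r) \<Longrightarrow> hom_poly c N a w = hom_poly d N a w"
  by (simp add: hom_poly_def)

lemma hom_poly_scale: "hom_poly (\<lambda>r. t * c r) N a w = t * hom_poly c N a w"
  by (simp add: hom_poly_def sum_distrib_left mult.assoc)

text \<open>The term \<open>r = 0\<close> vanishes, so the index can be shifted by one.\<close>

lemma sum_first_deriv:
  "(\<Sum>r\<le>Suc N. c r * (real r * a ^ (r - 1)) * w ^ (Suc N - r)) =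
     hom_poly (\<lambda>r. real (Suc r) * c (Suc r)) N a w"
  unfolding hom_poly_def by (subst sum.atMost_Suc_shift) (simp add: algebra_simps)

text \<open>The last term, \<open>r = Suc N\<close>, carries the factor 0.\<close>

lemma sum_second_deriv:
  "(\<Sum>r\<le>Suc N. c r * a ^ r * (real (Suc N - r) * w ^ (Suc N - r - 1))) =
     hom_poly (\<lambda>r. real (Suc N - r) * c r) N a w"
  unfolding hom_poly_def by (simp add: Suc_diff_le mult_ac add_diff_eq)

text \<open>Chain rule: the sums \<open>?A\<close> and \<open>?B\<close> are the partial derivatives
  in \<open>a\<close> and in \<open>w\<close>. As \<open>w = 2 * a - b\<close>, differentiating in
  \<open>a\<close> gives \<open>?A + 2 * ?B\<close> and differentiating in \<open>b\<close> gives
  \<open>- ?B\<close>.\<close>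

lemma dir_op_hom_poly:
  "dir_op \<alpha> \<beta> (\<lambda>a b. hom_poly c (Suc N) a (2 * a - b)) =
     (\<lambda>a b. hom_poly (\<lambda>r. \<alpha> * (real (Suc r) * c (Suc r)) + (2 * \<alpha> - \<beta>) * (real (Suc N - r) * c r))
              N a (2 * a - b))"
proof (intro ext)
  fix a b :: real
  let ?w = "2 * a - b"
  let ?A = "\<Sum>r\<le>Suc N. c r * (real r * a ^ (r - 1)) * ?w ^ (Suc N - r)"
  let ?B = "\<Sum>r\<le>Suc N. c r * a ^ r * (real (Suc N - r) * ?w ^ (Suc N - r - 1))"
  have "((\<lambda>t. hom_poly c (Suc N) t (2 * t - b)) has_real_derivative
      (\<Sum>r\<le>Suc N. c r * (real r * a ^ (r - 1)) * ?w ^ (Suc N - r) +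
         2 * (c r * a ^ r * (real (Suc N - r) * ?w ^ (Suc N - r - 1))))) (at a)"
    unfolding hom_poly_def
    by (rule DERIV_sum) (auto intro!: derivative_eq_intros simp: algebra_simps)
  then have A: "deriv (\<lambda>t. hom_poly c (Suc N) t (2 * t - b)) a = ?A + 2 * ?B"
    unfolding sum.distrib sum_distrib_left[symmetric] by (rule DERIV_imp_deriv)
  have "((\<lambda>t. hom_poly c (Suc N) a (2 * a - t)) has_real_derivative
      (\<Sum>r\<le>Suc N. (-1) * (c r * a ^ r * (real (Suc N - r) * ?w ^ (Suc N - r - 1))))) (at b)"
    unfolding hom_poly_def
    by (rule DERIV_sum) (auto intro!: derivative_eq_intros simp: algebra_simps)
  then have B: "deriv (\<lambda>t. hom_poly c (Suc N) a (2 * a - t)) b = (-1) * ?B"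
    unfolding sum_distrib_left[symmetric] by (rule DERIV_imp_deriv)
  have "dir_op \<alpha> \<beta> (\<lambda>a b. hom_poly c (Suc N) a (2 * a - b)) a b = \<alpha> * ?A + (2 * \<alpha> - \<beta>) * ?B"
    unfolding dir_op_def A B by (simp only: algebra_simps)
  also have "\<dots> = hom_poly (\<lambda>r. \<alpha> * (real (Suc r) * c (Suc r)) + (2 * \<alpha> - \<beta>) * (real (Suc N - r) * c r))
              N a ?w"
    unfolding sum_first_deriv sum_second_deriv
    by (simp only: hom_poly_def sum.distrib sum_distrib_left distrib_right mult.assoc)
  finally show "dir_op \<alpha> \<beta> (\<lambda>a b. hom_poly c (Suc N) a (2 * a - b)) a b = \<dots>" .
qed

lemma dir_op_const: "dir_op \<alpha> \<beta> (\<lambda>a b. c) = (\<lambda>a b. 0)"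
  by (simp add: dir_op_def)

lemma euler_hom_poly_aux:
  fixes c R A W s :: real
  shows "c * (R * A) * W + c * A * ((s - R) * W) = s * (c * A * W)"
  by (simp add: algebra_simps)

text \<open>Euler's identity for degree \<open>Suc N\<close>. The left-hand side has the
  coefficients of \<open>dir_op_hom_poly\<close> with \<open>\<alpha>\<close> equal to
  \<open>a\<close> and \<open>2 * \<alpha> - \<beta>\<close> equal to \<open>w\<close>.\<close>

lemma euler_hom_poly:
  "hom_poly (\<lambda>r. a * (real (Suc r) * c (Suc r)) + w * (real (Suc N - r) * c r)) N a w =
     real (Suc N) * hom_poly c (Suc N) a w"
proof -
  have "hom_poly (\<lambda>r. a * (real (Suc r) * c (Suc r)) + w * (real (Suc N - r) * c r)) N a w =
     a * hom_poly (\<lambda>r. real (Suc r) * c (Suc r)) N a w + w * hom_poly (\<lambda>r. real (Suc N - r) * c r) N a w"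
    by (simp only: hom_poly_def sum.distrib sum_distrib_left distrib_right mult.assoc)
  also have "\<dots> = (\<Sum>r\<le>Suc N. real (Suc N) * (c r * a ^ r * w ^ (Suc N - r)))"
    unfolding sum_first_deriv[symmetric] sum_second_deriv[symmetric] sum_distrib_left sum.distrib[symmetric]
  proof (rule sum.cong)
    fix r assume r: "r \<in> {..Suc N}"
    \<comment> \<open>The exponent \<open>r - 1\<close> is truncated at \<open>r = 0\<close>, where
      the factor \<open>real r\<close> is 0; the same happens at the other end in the next
      fact.\<close>
    have 1: "a * (real r * a ^ (r - 1)) = real r * a ^ r" by (cases r) auto
    have 2: "w * (real (Suc N - r) * w ^ (Suc N - r - 1)) = real (Suc N - r) * w ^ (Suc N - r)"
      by (cases "Suc N - r") auto
    have 3: "real (Suc N - r) = real (Suc N) - real r" using r by (simp add: of_nat_diff)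
    have "a * (c r * (real r * a ^ (r - 1)) * w ^ (Suc N - r)) +
       w * (c r * a ^ r * (real (Suc N - r) * w ^ (Suc N - r - 1))) =
       c r * (a * (real r * a ^ (r - 1))) * w ^ (Suc N - r) +
       c r * a ^ r * (w * (real (Suc N - r) * w ^ (Suc N - r - 1)))"
      by (simp only: ac_simps)
    also have "\<dots> = real (Suc N) * (c r * a ^ r * w ^ (Suc N - r))"
      unfolding 1 2 unfolding 3 by (rule euler_hom_poly_aux)
    finally show "a * (c r * (real r * a ^ (r - 1)) * w ^ (Suc N - r)) +
       w * (c r * a ^ r * (real (Suc N - r) * w ^ (Suc N - r - 1))) = \<dots>" .
  qed simp
  finally show ?thesis by (simp only: hom_poly_def sum_distrib_left)
qed

section \<open>The coefficients in (iii) and their recursions\<close>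

definition Omega_coeff :: "real \<Rightarrow> real \<Rightarrow> nat \<Rightarrow> nat \<Rightarrow> nat \<Rightarrow> real" where
  "Omega_coeff \<alpha> \<beta> n k r =
     (- 1) ^ (r + k) * (fact (n - r - k - 1) * real n / (fact (n - 2 * r) * fact r))
       * real ((n div 2 - r) choose k) * Omega r k \<alpha> \<beta> n"

text \<open>Unfolding the recursion of \<open>Omega\<close> at \<open>Suc k\<close> produces the two
  terms on the left. What remains is to match factorials and binomials, for which the parity of
  \<open>n\<close> enters only through \<open>d = delta (n - 1)\<close>.\<close>

lemma Omega_coeff_Suc:
  assumes "Suc (r + k) \<le> n div 2"
  shows "\<alpha> * (real (Suc r) * Omega_coeff \<alpha> \<beta> n k (Suc r))
      + (2 * \<alpha> - \<beta>) * (real (n div 2 - k - r) * Omega_coeff \<alpha> \<beta> n k r)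
      = - real (Suc k) * Omega_coeff \<alpha> \<beta> n (Suc k) r"
proof -
  define m where "m = n div 2"
  define s where "s = m - Suc (r + k)"
  define d where "d = delta (n - 1)"
  have m: "m = Suc (s + r + k)" using assms by (simp add: s_def m_def)
  consider "n = 2 * m" | "n = 2 * m + 1" unfolding m_def by linarith
  then have "n = 2 * m + 1 - d \<and> (d = 0 \<or> d = 1)"
  proof cases
    case 1
    then have "n - 1 = Suc (2 * (s + r + k))" by (simp add: m)
    then have "d = 1" by (simp add: d_def delta_def)
    with 1 show ?thesis by simp
  next
    case 2
    then have "d = 0" by (simp add: d_def delta_def)
    with 2 show ?thesis by simp
  qed
  then have nd: "n = 2 * m + 1 - d" and d: "d = 0 \<or> d = 1" by auto
  \<comment> \<open>\<open>F\<close> and \<open>G\<close> are the smallest factorials in the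
    numerators and in the denominators; all others reduce to them.\<close>
  define F :: real where "F = fact (2 * s + r + k + 1 - d)"
  define G :: real where "G = fact (2 * s + 2 * k + 1 - d)"
  have e1: "n - r - k - 1 = Suc (2 * s + r + k + 1 - d)" and e2: "n - Suc r - k - 1 = 2 * s + r + k + 1 - d"
    and e2': "n - r - Suc k - 1 = 2 * s + r + k + 1 - d"
    and e3: "n - 2 * r = Suc (Suc (2 * s + 2 * k + 1 - d))" and e4: "n - 2 * Suc r = 2 * s + 2 * k + 1 - d"
    using nd m d by auto
  have c1: "real (Suc k) * real ((m - r) choose Suc k) = real (Suc s) * real ((m - r) choose k)"
  proof -
    have "Suc k * (Suc (s + k) choose Suc k) = Suc s * (Suc (s + k) choose k)"
      using binomial_absorb_comp[of "Suc (s+k)" k] Suc_times_binomial_eq[of "s+k" k] 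
      by (simp add: ac_simps)
    moreover have "m - r = Suc (s + k)" using m by auto
    ultimately show ?thesis by (metis of_nat_mult)
  qed
  have c2: "real (Suc k) * real ((m - r) choose Suc k) = real (m - r) * real ((m - Suc r) choose k)"
  proof -
    have "Suc k * (Suc (s + k) choose Suc k) = Suc (s + k) * ((s + k) choose k)"
      using Suc_times_binomial_eq[of "s+k" k] by (simp add: ac_simps)
    moreover have "m - r = Suc (s + k)" "m - Suc r = s + k" using m by auto
    ultimately show ?thesis by (metis of_nat_mult)
  qed
  \<comment> \<open>By \<open>c1\<close> and \<open>c2\<close> all three binomial coefficients are
    expressible through \<open>B\<close>.\<close>
  define B where "B = real (Suc k) * real ((m - r) choose Suc k)"
  define O0 where "O0 = Omega r k \<alpha> \<beta> n"
  define O1 where "O1 = Omega (Suc r) k \<alpha> \<beta> n"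
  define w where "w = 2 * \<alpha> - \<beta>"
  define sg :: real where "sg = (-1) ^ (r + k)"
  have pos: "G > 0" "real (m - r) > 0" "real (Suc s) > 0" using m by (auto simp: G_def)
  have "real (m - r) \<noteq> 0" using m by auto
  \<comment> \<open>This explains the factor \<open>n - 2r - \<delta>(n-1)\<close> in the recursion:
    of the consecutive numbers \<open>n - 2r\<close> and \<open>n - 2r - 1\<close>, the even one is
    \<open>2(m - r)\<close> and the odd one is \<open>n - 2r - d\<close>.\<close>
  have nn: "real (Suc (Suc (2 * s + 2 * k + 1 - d))) * real (Suc (2 * s + 2 * k + 1 - d)) 
     = 2 * real (m - r) * (real n - 2 * real r - real d)"
    using d nd m by (auto simp: algebra_simps)
  have H: "fact (Suc r) = real (Suc r) * (fact r :: real)" "(-1) ^ (Suc r + k) = - sg" by (simp_all add: sg_def)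
  have t1: "real (Suc r) * Omega_coeff \<alpha> \<beta> n k (Suc r) = - sg * F * real n / (G * fact r) * (B / real (m - r)) * O1"
    unfolding Omega_coeff_def m_def[symmetric] e2 e4 B_def c2 F_def[symmetric] G_def[symmetric] O1_def[symmetric] H
    using pos by (simp del: of_nat_Suc)
  have mr: "n div 2 - k - r = Suc s" using m m_def by auto
  have f1: "real (n - r - k - 1) = real n - real r - real (Suc k)" using e1 nd m d by auto
  have t2: "real (Suc s) * Omega_coeff \<alpha> \<beta> n k r = 
     sg * (real n - real r - real (Suc k)) * F * real n / (2 * real (m - r) * (real n - 2 * real r - real d) * G * fact r) * B * O0"
    unfolding Omega_coeff_def m_def[symmetric] B_def c1 nn[symmetric]  O0_def[symmetric] f1[symmetric]
    unfolding e1 e3 fact_Suc[where 'a=real] F_def[symmetric] G_def[symmetric] sg_def by (simp add: mult_ac)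
  have t3: "real (Suc k) * Omega_coeff \<alpha> \<beta> n (Suc k) r = 
     - sg * F * real n / (2 * real (m - r) * (real n - 2 * real r - real d) * G * fact r) * B * 
     (w * (real n - real r - real (Suc k)) * O0 - 2 * \<alpha> * (real n - 2 * real r - real d) * O1)"
    unfolding Omega_coeff_def m_def[symmetric] B_def nn[symmetric] Omega.simps O0_def[symmetric] 
      O1_def[symmetric] d_def[symmetric] w_def[symmetric]
    unfolding e2' e3 fact_Suc[where 'a=real] F_def[symmetric] G_def[symmetric] sg_def by (simp add: mult_ac)
  have nz: "real n - 2 * real r - real d \<noteq> 0" using d nd m by auto
  have combine: "- sg * F * N' / (2 * M * N * G * H') * B * (w * Q * O0 - 2 * \<alpha> * N * O1) =
      - (\<alpha> * (- sg * F * N' / (G * H') * (B / M) * O1) + w * (sg * Q * F * N' / (2 * M * N * G * H') * B * O0))"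
    if "M \<noteq> 0" "N \<noteq> 0" "H' \<noteq> 0" for M N N' H' Q :: real
    using that pos(1) by (simp add: field_simps)
  have "real (Suc k) * Omega_coeff \<alpha> \<beta> n (Suc k) r = - (\<alpha> * (real (Suc r) * Omega_coeff \<alpha> \<beta> n k (Suc r))
      + w * (real (n div 2 - k - r) * Omega_coeff \<alpha> \<beta> n k r))"
    unfolding t1 t2 t3 mr by (rule combine[OF \<open>real (m - r) \<noteq> 0\<close> nz]) simp
  then show ?thesis by (simp only: w_def mult_minus_left minus_minus)
qed

text \<open>The case \<open>k = 0\<close> of \<open>Omega_coeff\<close> up to sign, but set to zero for \<open>2r > n\<close>, which makes
  Pascal's rule hold for all \<open>r\<close> once \<open>n \<ge> 1\<close>.\<close>

definition lucas_coeff :: "nat \<Rightarrow> nat \<Rightarrow> real" where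
  "lucas_coeff n r = (if 2 * r \<le> n then fact (n - r - 1) * real n / (fact (n - 2 * r) * fact r) else 0)"

lemma lucas_coeff_0: "n \<ge> 1 \<Longrightarrow> lucas_coeff n 0 = 1"
  by (cases n) (auto simp: lucas_coeff_def)

lemma lucas_coeff_diag: "r \<ge> 1 \<Longrightarrow> lucas_coeff (2 * r) r = 2"
  by (cases r) (simp_all add: lucas_coeff_def divide_eq_eq)

lemma lucas_coeff_Suc:
  assumes "n \<ge> 1"
  shows "lucas_coeff (Suc (Suc n)) (Suc r) = lucas_coeff (Suc n) (Suc r) + lucas_coeff n r"
proof -
  consider "2 * r > n" | "2 * r = n" | "2 * r < n" by linarith
  then show ?thesis
  proof cases
    case 1 then show ?thesis by (simp add: lucas_coeff_def)
  next
    case 2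
    then have "lucas_coeff (Suc (Suc n)) (Suc r) = 2" "lucas_coeff n r = 2"
      using assms lucas_coeff_diag[of r] lucas_coeff_diag[of "Suc r"] by auto
    moreover have "lucas_coeff (Suc n) (Suc r) = 0" using 2 by (simp add: lucas_coeff_def)
    ultimately show ?thesis by simp
  next
    case 3
    define s where "s = n - 2 * r - 1"
    have n: "n = Suc (s + 2 * r)" using 3 by (simp add: s_def)
    define G :: real where "G = fact s"
    define H :: real where "H = fact r"
    define F :: real where "F = fact (s + r)"
    \<comment> \<open>After clearing denominators the claim is
      \<open>(u+v-1)(v+2u) = v(v+2u-1) + u(v+2u-2)\<close>.\<close>
    define u v :: real where "u = real (Suc r)" and "v = real (Suc s)"
    have pos: "F > 0" "G > 0" "H > 0" "u > 0" "v > 0"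
      by (auto simp: F_def G_def H_def u_def v_def)
    have "n - r - 1 = s + r" "Suc n - Suc r - 1 = s + r" "Suc (Suc n) - Suc r - 1 = Suc (s + r)"
      "n - 2 * r = Suc s" "Suc n - 2 * Suc r = s" "Suc (Suc n) - 2 * Suc r = Suc s"
      "2 * r \<le> n" "2 * Suc r \<le> Suc n" "2 * Suc r \<le> Suc (Suc n)"
      using n by auto
    note * = this
    have F': "fact (Suc (s + r)) = (u + v - 1) * F" "fact (Suc r) = u * H" "fact (Suc s) = v * G"
      "real n = v + 2 * u - 2" "real (Suc n) = v + 2 * u - 1" "real (Suc (Suc n)) = v + 2 * u"
      using n by (auto simp: u_def v_def F_def G_def H_def algebra_simps)
    show ?thesis
      unfolding lucas_coeff_def * F' F_def[symmetric] G_def[symmetric] H_def[symmetric]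
      using * pos by (simp add: field_simps)
  qed
qed

text \<open>Pascal's rule for \<open>lucas_coeff\<close> matches the recursion of
  \<open>Psi\<close>. At index 0 the closed form gives 0 instead of 2, so index 2 is computed
  directly.\<close>

lemma Psi_eq_hom_poly:
  "n \<ge> 1 \<Longrightarrow> Psi a b n = hom_poly (\<lambda>r. (-1) ^ r * lucas_coeff n r) (n div 2) a (2 * a - b)"
proof (induction a b n rule: Psi.induct)
  case (1 a b) then show ?case by simp
next
  case (2 a b) then show ?case by (simp add: hom_poly_def lucas_coeff_def)
next
  case (3 a b n)
  let ?w = "2 * a - b"
  let ?m = "n div 2"
  show ?case
  proof (cases "n = 0")
    case True
    then show ?thesis by (simp add: hom_poly_def lucas_coeff_def delta_def field_simps)
  next
    case False
    let ?t = "\<lambda>n r. (-1) ^ r * lucas_coeff n r * a ^ r"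
    \<comment> \<open>The power of \<open>?w\<close> brings both parities to degree
      \<open>Suc ?m\<close>: for odd \<open>n\<close> the degree is already right, for even
      \<open>n\<close> the extra factor raises it and the added top coefficient is 0.\<close>
    have A: "?w ^ delta (Suc n) * Psi a b (Suc n) = (\<Sum>r\<le>Suc ?m. ?t (Suc n) r * ?w ^ (Suc ?m - r))"
    proof (cases "even n")
      case True
      then have "Suc n div 2 = ?m" "lucas_coeff (Suc n) (Suc ?m) = 0" "delta (Suc n) = 1"
        by (auto simp: lucas_coeff_def delta_def)
      with 3(1) show ?thesis
        by (simp add: hom_poly_def sum_distrib_left Suc_diff_le mult_ac)
    next
      case False
      then have "Suc n div 2 = Suc ?m" "delta (Suc n) = 0"
        by (auto simp: delta_def elim!: oddE)
      with 3(1) show ?thesis by (simp add: hom_poly_def del: sum.atMost_Suc)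
    qed
    have "Psi a b (Suc (Suc n)) = (\<Sum>r\<le>Suc ?m. ?t (Suc n) r * ?w ^ (Suc ?m - r))
        - a * (\<Sum>r\<le>?m. ?t n r * ?w ^ (?m - r))"
      using A 3(2) False by (simp add: hom_poly_def del: sum.atMost_Suc)
    also have "\<dots> = (\<Sum>r\<le>Suc ?m. ?t (Suc (Suc n)) r * ?w ^ (Suc ?m - r))"
      using False by (simp add: sum.atMost_Suc_shift lucas_coeff_0 lucas_coeff_Suc sum_distrib_left
        ring_distribs sum.distrib sum_subtractf sum_negf mult_ac del: sum.atMost_Suc)
    finally show ?thesis by (simp add: hom_poly_def)
  qed
qed

lemma Psi_eq_hom_poly_Omega_coeff:
  assumes "n \<ge> 1"
  shows "Psi a b n = hom_poly (Omega_coeff \<alpha> \<beta> n 0) (n div 2) a (2 * a - b)"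
  unfolding Psi_eq_hom_poly[OF assms]
  by (rule hom_poly_cong) (auto simp: Omega_coeff_def lucas_coeff_def)

text \<open>Each differentiation contributes the factor \<open>- real (Suc k)\<close> of
  \<open>Omega_coeff_Suc\<close>; these accumulate to \<open>(-1) ^ k * fact k\<close>.\<close>

lemma dir_op_pow_Psi:
  assumes "n \<ge> 1" "k \<le> n div 2"
  shows "(dir_op \<alpha> \<beta> ^^ k) (\<lambda>a b. Psi a b n) =
    (\<lambda>a b. hom_poly (\<lambda>r. (-1) ^ k * fact k * Omega_coeff \<alpha> \<beta> n k r) (n div 2 - k) a (2 * a - b))"
  using assms(2)
proof (induction k)
  case 0
  then show ?case using Psi_eq_hom_poly_Omega_coeff[OF assms(1)] by simp
next
  case (Suc k)
  then obtain N where N: "n div 2 - k = Suc N" "n div 2 - Suc k = N"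
    by (metis Suc_diff_Suc Suc_le_lessD)
  have "(dir_op \<alpha> \<beta> ^^ Suc k) (\<lambda>a b. Psi a b n) = 
     (\<lambda>a b. hom_poly (\<lambda>r. \<alpha> * (real (Suc r) * ((-1) ^ k * fact k * Omega_coeff \<alpha> \<beta> n k (Suc r))) 
      + (2 * \<alpha> - \<beta>) * (real (Suc N - r) * ((-1) ^ k * fact k * Omega_coeff \<alpha> \<beta> n k r))) N a (2 * a - b))"
    using Suc by (simp add: N dir_op_hom_poly)
  also have "\<dots> = (\<lambda>a b. hom_poly (\<lambda>r. (-1) ^ Suc k * fact (Suc k) * Omega_coeff \<alpha> \<beta> n (Suc k) r) N a (2 * a - b))"
  proof (intro ext hom_poly_cong)
    fix r assume "r \<le> N"
    then have "Suc (r + k) \<le> n div 2" using N by linarith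
    from Omega_coeff_Suc[OF this, of \<alpha> \<beta>] 
    have "(-1) ^ k * fact k * (\<alpha> * (real (Suc r) * Omega_coeff \<alpha> \<beta> n k (Suc r))
      + (2 * \<alpha> - \<beta>) * (real (Suc N - r) * Omega_coeff \<alpha> \<beta> n k r)) = 
      (-1) ^ k * fact k * (- real (Suc k) * Omega_coeff \<alpha> \<beta> n (Suc k) r)" unfolding N by simp
    then show "\<alpha> * (real (Suc r) * ((-1) ^ k * fact k * Omega_coeff \<alpha> \<beta> n k (Suc r))) 
      + (2 * \<alpha> - \<beta>) * (real (Suc N - r) * ((-1) ^ k * fact k * Omega_coeff \<alpha> \<beta> n k r)) = 
      (-1) ^ Suc k * fact (Suc k) * Omega_coeff \<alpha> \<beta> n (Suc k) r"
      by (simp add: algebra_simps)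
  qed
  finally show ?case by (simp only: N)
qed

text \<open>After \<open>n div 2\<close> differentiations only a constant is left.\<close>

lemma dir_op_pow_Psi_eq_0:
  assumes "n \<ge> 1" "k > n div 2"
  shows "(dir_op \<alpha> \<beta> ^^ k) (\<lambda>a b. Psi a b n) = (\<lambda>a b. 0)"
  using assms(2)
proof (induction k)
  case (Suc k)
  show ?case
  proof (cases "k = n div 2")
    case True
    then show ?thesis using dir_op_pow_Psi[OF assms(1), of k \<alpha> \<beta>]
      by (simp add: hom_poly_def dir_op_const)
  next
    case False
    with Suc show ?thesis by (simp add: dir_op_const)
  qed
qed simp

section \<open>Evaluation at the point itself\<close>

text \<open>At \<open>a = \<alpha>\<close>, \<open>b = \<beta>\<close> Euler's identity turns each
  differentiation into multiplication by the current degree \<open>n div 2 - k\<close>. Dividing by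
  \<open>Suc k\<close> each time builds up the binomial coefficient.\<close>

lemma hom_poly_Omega_coeff_diag:
  assumes "k \<le> n div 2"
  shows "hom_poly (Omega_coeff \<alpha> \<beta> n k) (n div 2 - k) \<alpha> (2 * \<alpha> - \<beta>) =
    (-1) ^ k * real ((n div 2) choose k) * hom_poly (Omega_coeff \<alpha> \<beta> n 0) (n div 2) \<alpha> (2 * \<alpha> - \<beta>)"
  using assms
proof (induction k)
  case (Suc k)
  then obtain N where N: "n div 2 - k = Suc N" "n div 2 - Suc k = N"
    by (metis Suc_diff_Suc Suc_le_lessD)
  let ?w = "2 * \<alpha> - \<beta>"
  let ?H = "hom_poly (Omega_coeff \<alpha> \<beta> n 0) (n div 2) \<alpha> ?w"
  have "- real (Suc k) * hom_poly (Omega_coeff \<alpha> \<beta> n (Suc k)) N \<alpha> ?w =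
     hom_poly (\<lambda>r. \<alpha> * (real (Suc r) * Omega_coeff \<alpha> \<beta> n k (Suc r))
      + ?w * (real (Suc N - r) * Omega_coeff \<alpha> \<beta> n k r)) N \<alpha> ?w"
    unfolding hom_poly_scale[symmetric]
  proof (rule hom_poly_cong)
    fix r assume "r \<le> N"
    then have "Suc (r + k) \<le> n div 2" using N by linarith
    from Omega_coeff_Suc[OF this, of \<alpha> \<beta>]
    show "- real (Suc k) * Omega_coeff \<alpha> \<beta> n (Suc k) r = \<alpha> * (real (Suc r) * Omega_coeff \<alpha> \<beta> n k (Suc r))
      + ?w * (real (Suc N - r) * Omega_coeff \<alpha> \<beta> n k r)" unfolding N by simp
  qed
  also have "\<dots> = real (n div 2 - k) * ((-1) ^ k * real ((n div 2) choose k) * ?H)"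
    unfolding euler_hom_poly using Suc N by simp
  also have "real (n div 2 - k) * ((-1) ^ k * real ((n div 2) choose k) * ?H) = 
     (-1) ^ k * real ((n div 2 - k) * ((n div 2) choose k)) * ?H" by simp
  also have "(n div 2 - k) * ((n div 2) choose k) = Suc k * ((n div 2) choose Suc k)"
    using binomial_absorb_comp[of "n div 2" k] times_binomial_minus1_eq[of "Suc k" "n div 2"] by simp
  finally have E: "- real (Suc k) * hom_poly (Omega_coeff \<alpha> \<beta> n (Suc k)) N \<alpha> ?w =
     (-1) ^ k * real (Suc k * ((n div 2) choose Suc k)) * ?H" .
  have "real (Suc k) * hom_poly (Omega_coeff \<alpha> \<beta> n (Suc k)) N \<alpha> ?w =
     - (- real (Suc k) * hom_poly (Omega_coeff \<alpha> \<beta> n (Suc k)) N \<alpha> ?w)"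
    by (simp del: of_nat_Suc)
  also have "\<dots> = real (Suc k) * ((-1) ^ Suc k * real ((n div 2) choose Suc k) * ?H)"
    unfolding E of_nat_mult by (simp del: of_nat_Suc)
  finally show ?case unfolding N by (subst (asm) mult_left_cancel) auto
qed simp

lemma fact_eq_prod_diff:
  assumes "m < n"
  shows "(fact (n - 1) :: real) = fact (n - m - 1) * (\<Prod>i = 1..m. real n - real i)"
  using assms
proof (induction m)
  case (Suc m)
  have "n - m - 1 = Suc (n - Suc m - 1)" using Suc.prems by simp
  then have "(fact (n - m - 1) :: real) = (real n - real (Suc m)) * fact (n - Suc m - 1)"
    using Suc.prems by (simp add: of_nat_diff)
  then show ?case using Suc by simp
qed simp

text \<open>For \<open>k = n div 2\<close> the polynomial in
  \<open>hom_poly_Omega_coeff_diag\<close> has the single term \<open>r = 0\<close>, a multiple of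
  \<open>Omega 0 k\<close>. The product form, free of division, also serves the divisibility
  claim.\<close>

lemma Omega_eq_Psi:
  assumes "n \<ge> 1"
  shows "Omega 0 (n div 2) \<zeta> \<xi> n = Psi \<zeta> \<xi> n * (\<Prod>i = 1..n div 2. real n - real i)"
proof -
  let ?m = "n div 2"
  let ?P = "\<Prod>i = 1..n div 2. real n - real i"
  have "Omega_coeff \<zeta> \<xi> n ?m 0 = (-1) ^ ?m * Psi \<zeta> \<xi> n"
    using hom_poly_Omega_coeff_diag[of ?m n \<zeta> \<xi>] Psi_eq_hom_poly_Omega_coeff[OF assms, of \<zeta> \<xi> \<zeta> \<xi>]
    by (simp add: hom_poly_def)
  then have "(-1) ^ ?m * (fact (n - ?m - 1) * real n / fact n * Omega 0 ?m \<zeta> \<xi> n) = (-1) ^ ?m * Psi \<zeta> \<xi> n"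
    by (simp add: Omega_coeff_def)
  then have "fact (n - ?m - 1) * real n / fact n * Omega 0 ?m \<zeta> \<xi> n = Psi \<zeta> \<xi> n"
    by (subst (asm) mult_left_cancel) auto
  moreover have "(fact n :: real) = real n * (fact (n - ?m - 1) * ?P)"
    using assms fact_eq_prod_diff[of ?m n] by (cases n) auto
  ultimately show ?thesis using assms by (auto simp: field_simps)
qed

text \<open>Power sums satisfy \<open>s(n+2) = (x+y) s(n+1) - xy s(n)\<close>. The factor on the
  left replaces a division by \<open>x + y\<close>.\<close>

lemma Psi_power_sum:
  "(x + y) ^ delta n * Psi (x * y) (- x\<^sup>2 - y\<^sup>2) n = x ^ n + y ^ n"
proof (induction "x * y" "- x\<^sup>2 - y\<^sup>2" n rule: Psi.induct)
  case (3 n)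
  have w: "2 * (x * y) - (- x\<^sup>2 - y\<^sup>2) = (x + y)\<^sup>2" by (simp add: power2_eq_square algebra_simps)
  have d: "delta (Suc (Suc n)) = delta n" by (simp add: delta_def)
  \<comment> \<open>Comparison of exponents:
    \<open>delta n + 2 * delta (n+1) = 1 + delta (n+1)\<close> in both parities.\<close>
  have e: "(x + y) ^ delta n * ((x + y)\<^sup>2) ^ delta (Suc n) = (x + y) * (x + y) ^ delta (Suc n)"
    by (cases "even n") (auto simp: delta_def even_iff_mod_2_eq_zero mod_Suc odd_iff_mod_2_eq_one power2_eq_square)
  have "(x + y) ^ delta n * Psi (x * y) (- x\<^sup>2 - y\<^sup>2) (Suc (Suc n)) =
     ((x + y) ^ delta n * ((x + y)\<^sup>2) ^ delta (Suc n)) * Psi (x * y) (- x\<^sup>2 - y\<^sup>2) (Suc n)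
     - x * y * ((x + y) ^ delta n * Psi (x * y) (- x\<^sup>2 - y\<^sup>2) n)"
    unfolding Psi.simps w by (simp only: right_diff_distrib mult_ac)
  also have "\<dots> = (x + y) * (x ^ Suc n + y ^ Suc n) - x * y * (x ^ n + y ^ n)"
    unfolding e 3(2) using 3(1) by (simp add: mult.assoc)
  also have "\<dots> = x ^ Suc (Suc n) + y ^ Suc (Suc n)" by (simp add: algebra_simps)
  finally show ?case unfolding d .
qed (simp_all add: delta_def)

section \<open>Bertrand's postulate\<close>

text \<open>Induction along Leibniz's harmonic triangle
  \<open>1 / (n C(n-1,k+1)) = 1 / ((n-1) C(n-2,k)) - 1 / (n C(n-1,k))\<close>. The divisibility makes
  Legendre's formula unnecessary for bounding the prime powers dividing a binomial coefficient.\<close>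

lemma binomial_times_dvd_Lcm:
  "k < n \<Longrightarrow> n * ((n - 1) choose k) dvd Lcm {1..n}"
proof (induction k arbitrary: n)
  case 0
  then show ?case by (simp add: dvd_Lcm)
next
  case (Suc k)
  then obtain N where n: "n = Suc N" and N: "k < N" by (cases n) auto
  \<comment> \<open>The cofactor of \<open>n * B\<close> in \<open>L\<close> will be the difference
    \<open>p - q\<close> of two cofactors, hence the passage to integers.\<close>
  define L where "L = int (Lcm {1..n})"
  define A where "A = int (N choose k)"
  define B where "B = int (N choose Suc k)"
  define C where "C = int ((N - 1) choose k)"
  have "n * (N choose k) dvd Lcm {1..n}"
    using Suc.IH[of n] Suc.prems n by simp
  then have "int n * A dvd L" unfolding A_def L_def by (metis of_nat_dvd_iff of_nat_mult)
  then obtain q where q: "L = int n * A * q" by (auto elim: dvdE)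
  have "N * ((N - 1) choose k) dvd Lcm {1..N}"
    using Suc.IH[of N] N by simp
  also have "Lcm {1..N} dvd Lcm {1..n}" by (intro Lcm_subset) (auto simp: n)
  finally have "int N * C dvd L" unfolding C_def L_def by (metis of_nat_dvd_iff of_nat_mult)
  then obtain p where p: "L = int N * C * p" by (auto elim: dvdE)
  have 1: "int (Suc k) * B = int N * C"
  proof -
    have "Suc k * (N choose Suc k) = N * ((N - 1) choose k)"
      using times_binomial_minus1_eq[of "Suc k" N] by simp
    then show ?thesis unfolding B_def C_def by (metis of_nat_mult)
  qed
  have 2: "(int N - int k) * A = int N * C"
  proof -
    have "(N - k) * (N choose k) = N * ((N - 1) choose k)"
      using N binomial_absorb_comp[of N k] by simp
    then have "int (N - k) * A = int N * C" unfolding A_def C_def by (metis of_nat_mult)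
    then show ?thesis using N by (simp add: of_nat_diff)
  qed
  have pos: "A > 0" "int (Suc k) > 0" using N by (auto simp: A_def)
  have "int (Suc k) * (int n * B * (p - q)) = int n * (p * (int (Suc k) * B)) - int (Suc k) * B * (int n * q)"
    by (simp add: algebra_simps)
  also have "int (Suc k) * B = (int N - int k) * A" using 1 2 by simp
  also have "int n * (p * ((int N - int k) * A)) - (int N - int k) * A * (int n * q) = 
     int n * L - (int N - int k) * L"
  proof -
    have "p * ((int N - int k) * A) = p * (int N * C)" by (simp only: 2)
    then have "p * ((int N - int k) * A) = L" by (simp only: p mult_ac)
    moreover have "(int N - int k) * A * (int n * q) = (int N - int k) * L" by (simp only: q mult_ac)
    ultimately show ?thesis by (simp only:)
  qed
  also have "\<dots> = int (Suc k) * L" by (simp add: n algebra_simps)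
  finally have "L = int n * B * (p - q)" using pos by simp
  then have "int n * B dvd L" by simp
  then have "n * (N choose Suc k) dvd Lcm {1..n}" unfolding B_def L_def
    by (metis of_nat_dvd_iff of_nat_mult)
  then show ?case by (simp add: n)
qed

lemma binomial_dvd_Lcm:
  assumes "0 < k" "k \<le> n"
  shows "n choose k dvd Lcm {1..n}"
proof -
  have "k * (n choose k) = n * ((n - 1) choose (k - 1))"
    using assms by (intro times_binomial_minus1_eq)
  then have "n choose k dvd n * ((n - 1) choose (k - 1))" by (metis dvd_triv_right)
  also have "\<dots> dvd Lcm {1..n}" using assms by (intro binomial_times_dvd_Lcm) simp
  finally show ?thesis .
qed

section \<open>Prime powers dividing binomial coefficients\<close>

lemma prime_power_dvd_lcm:
  fixes p x y :: nat
  assumes "prime p" "x \<noteq> 0" "y \<noteq> 0" "p ^ a dvd lcm x y"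
  shows "p ^ a dvd x \<or> p ^ a dvd y"
proof -
  have "lcm x y \<noteq> 0" using assms by simp
  then have "a \<le> multiplicity p (lcm x y)" using assms by (intro multiplicity_geI) auto
  then have "a \<le> multiplicity p x \<or> a \<le> multiplicity p y"
    by (simp add: multiplicity_lcm assms(1-3) le_max_iff_disj)
  then show ?thesis by (auto intro: multiplicity_dvd')
qed

text \<open>A prime power dividing a least common multiple divides one of its arguments, here a
  number between 1 and \<open>n\<close>.\<close>

lemma prime_power_dvd_Lcm_le:
  fixes p :: nat
  assumes "prime p" "p ^ a dvd Lcm {1..n}" "n \<ge> 1"
  shows "p ^ a \<le> n"
  using assms(2,3)
proof (induction n)
  case (Suc n)
  show ?case
  proof (cases "n = 0")
    case True
    with Suc.prems show ?thesis by auto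
  next
    case False
    have "{1..Suc n} = insert (Suc n) {1..n}" by auto
    then have "Lcm {1..Suc n} = lcm (Suc n) (Lcm {1..n})" by simp
    then have "p ^ a dvd Suc n \<or> p ^ a dvd Lcm {1..n}"
      using Suc.prems(1) prime_power_dvd_lcm[OF assms(1), of "Suc n" "Lcm {1..n}" a]
      by (simp add: Lcm_0_iff)
    with Suc.IH False show ?thesis using dvd_imp_le by fastforce
  qed
qed simp

lemma prime_power_dvd_binomial_le:
  fixes p :: nat
  assumes "prime p" "p ^ a dvd n choose k" "0 < k" "k \<le> n"
  shows "p ^ a \<le> n"
  using assms binomial_dvd_Lcm[of k n] by (intro prime_power_dvd_Lcm_le[of p]) (auto intro: dvd_trans)

section \<open>Chebyshev's bound on the product of the primes\<close>

lemma prod_primes_dvd: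
  fixes A :: "nat set"
  assumes "finite A" "\<And>p. p \<in> A \<Longrightarrow> prime p" "\<And>p. p \<in> A \<Longrightarrow> p dvd m"
  shows "\<Prod>A dvd m"
  using assms
proof (induction A rule: finite_induct)
  case (insert p A)
  have "coprime p (\<Prod>A)"
    using insert by (intro prod_coprime_right) (auto intro!: primes_coprime)
  then show ?case using insert by (auto intro!: divides_mult)
qed simp

text \<open>For \<open>n = 2m + 1\<close> the primes above \<open>m + 1\<close> all divide
  \<open>n choose m\<close>, which is at most \<open>4 ^ m\<close>; the induction hypothesis covers
  those up to \<open>m + 1\<close>. An even \<open>n > 2\<close> adds no prime.\<close>

lemma prod_primes_le_4_pow: "\<Prod>{p::nat. prime p \<and> p \<le> n} \<le> 4 ^ n"
proof (induction n rule: less_induct)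
  case (less n)
  let ?P = "\<lambda>n. {p::nat. prime p \<and> p \<le> n}"
  consider "n \<le> 1" | "n = 2" | "n > 2" "even n" | "n > 2" "odd n" by linarith
  then show ?case
  proof cases
    case 1
    then have "?P n = {}" by (auto dest: prime_gt_1_nat)
    show ?thesis unfolding \<open>?P n = {}\<close> by simp
  next
    case 2
    then have "?P n = {2}" by (auto dest: prime_gt_1_nat)
    then show ?thesis using 2 by simp
  next
    case 3
    then have "\<not> prime n" using prime_odd_nat by blast
    then have "p \<le> n - 1" if "prime p" "p \<le> n" for p using that by (cases "p = n") auto
    then have "?P n = ?P (n - 1)" by auto
    moreover have "\<Prod>(?P (n - 1)) \<le> 4 ^ (n - 1)" using 3 by (intro less.IH) simp
    moreover have "(4::nat) ^ (n - 1) \<le> 4 ^ n" by (rule power_increasing) auto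
    ultimately show ?thesis by (metis order_trans)
  next
    case 4
    then obtain m where n: "n = 2 * m + 1" by (elim oddE)
    have m: "m \<ge> 1" using 4 n by simp
    let ?Q = "{p::nat. prime p \<and> m + 1 < p \<and> p \<le> n}"
    have "\<Prod>?Q dvd n choose m"
    proof (rule prod_primes_dvd)
      fix p assume p: "p \<in> ?Q"
      have "fact m * fact (n - m) * (n choose m) = (fact n :: nat)"
        by (rule binomial_fact_lemma) (simp add: n)
      then have "p dvd fact m * fact (n - m) * (n choose m)" using p prime_dvd_fact_iff[of p n] by simp
      moreover have "\<not> p dvd fact m" "\<not> p dvd fact (n - m)" using p n prime_dvd_fact_iff[of p m] 
        prime_dvd_fact_iff[of p "n - m"] by auto
      ultimately show "p dvd n choose m" using p by (auto simp: prime_dvd_mult_iff)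
    qed auto
    then have "\<Prod>?Q \<le> n choose m" by (rule dvd_imp_le) (simp add: n)
    also have "n choose m \<le> 4 ^ m"
    proof -
      \<comment> \<open>The two equal middle entries of row \<open>2m + 1\<close> sum to at most
        \<open>2 * 4 ^ m\<close>.\<close>
      have "(n choose m) + (n choose (Suc m)) = (\<Sum>k\<in>{m, Suc m}. n choose k)" by simp
      also have "\<dots> \<le> (\<Sum>k\<le>n. n choose k)" by (rule sum_mono2) (auto simp: n)
      also have "\<dots> = 2 * 4 ^ m" unfolding choose_row_sum by (simp add: n power_mult)
      finally show ?thesis using binomial_symmetric[of m n] by (simp add: n)
    qed
    finally have Q: "\<Prod>?Q \<le> 4 ^ m" .
    have "?P n = ?P (m + 1) \<union> ?Q" by (auto simp: n)
    then have "\<Prod>(?P n) = \<Prod>(?P (m + 1)) * \<Prod>?Q"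
      by (simp only:) (rule prod.union_disjoint, auto)
    also have "\<dots> \<le> 4 ^ (m + 1) * 4 ^ m"
      using m by (intro mult_mono Q less.IH) (auto simp: n)
    also have "\<dots> = 4 ^ n" by (simp add: n power_add[symmetric])
    finally show ?thesis .
  qed
qed

text \<open>The only multiples of \<open>p\<close> up to \<open>2n\<close> are \<open>p\<close> and \<open>2p\<close>, so \<open>p\<^sup>3\<close> does not divide \<open>(2n)!\<close>.\<close>

lemma not_dvd_central_binomial:
  fixes p :: nat
  assumes "prime p" "p > 2" "p \<le> n" "2 * n < 3 * p"
  shows "\<not> p dvd (2 * n) choose n"
proof
  assume C: "p dvd (2 * n) choose n"
  have "p dvd fact n" using assms by (simp add: prime_dvd_fact_iff)
  then have "p * p * p dvd fact n * fact n * ((2 * n) choose n)" using C by (intro mult_dvd_mono)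
  also have "fact n * fact n * ((2 * n) choose n) = fact (2 * n)"
    using binomial_fact_lemma[of n "2 * n"] by simp
  also have "(fact (2 * n) :: nat) = \<Prod>{1..2 * n}" by (simp add: fact_prod)
  also have "{1..2 * n} = {p, 2 * p} \<union> ({1..2 * n} - {p, 2 * p})" using assms by auto
  also have "\<Prod>\<dots> = \<Prod>{p, 2 * p} * \<Prod>({1..2 * n} - {p, 2 * p})"
    by (rule prod.union_disjoint) auto
  also have "\<Prod>{p, 2 * p} = p * p * 2" using assms by simp
  finally have "p dvd 2 * \<Prod>({1..2 * n} - {p, 2 * p})"
    using assms by (simp add: mult.assoc)
  then have "p dvd \<Prod>({1..2 * n} - {p, 2 * p})"
    using assms prime_dvd_mult_iff[of p 2] dvd_imp_le[of p 2] by auto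
  then have "\<exists>i\<in>{1..2 * n} - {p, 2 * p}. p dvd i"
    using assms by (simp add: prime_dvd_prod_iff)
  then obtain i where i: "i \<in> {1..2 * n} - {p, 2 * p}" "p dvd i" by blast
  then obtain j where j: "i = p * j" by (elim dvdE)
  have "p * j \<le> 2 * n" using i j by simp
  then have "p * j < p * 3" using assms by linarith
  then have "j < 3" by simp
  then consider "j = 0" | "j = 1" | "j = 2" by linarith
  then show False using i j by cases auto
qed

section \<open>Estimates for the central binomial coefficient\<close>

text \<open>At \<open>t = 30\<close> this is \<open>31^6 < 32^6\<close>. From there on a step
  multiplies the left side by at most \<open>(32/31)^6 < 2\<close>.\<close>

lemma exponential_beats_power_6:
  fixes t :: nat
  assumes "t \<ge> 30"
  shows "(t + 1) ^ 6 < 2 ^ t"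
  using assms
proof (induction t rule: nat_induct_at_least)
  case base
  then show ?case by simp
next
  case (Suc t)
  have "31 ^ 6 * (Suc t + 1) ^ 6 = (31 * (Suc t + 1)) ^ 6" by (rule power_mult_distrib[symmetric])
  also have "\<dots> \<le> (32 * (t + 1)) ^ 6" using Suc.hyps by (intro power_mono) auto
  also have "\<dots> = 32 ^ 6 * (t + 1) ^ 6" by (rule power_mult_distrib)
  also have "\<dots> \<le> 2 * 31 ^ 6 * (t + 1) ^ 6" by (intro mult_right_mono) auto
  finally have "(Suc t + 1) ^ 6 \<le> 2 * (t + 1) ^ 6" by simp
  also have "\<dots> < 2 ^ Suc t" using Suc.IH by simp
  finally show ?case .
qed

text \<open>Without primes in \<open>(n, 2n]\<close>, no prime above \<open>2n/3\<close> divides the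
  coefficient. At most \<open>t - 1\<close> primes are \<open>\<le> t\<close>, each with a prime
  power of at most \<open>2n\<close>. Primes above \<open>t\<close> occur only to the first power,
  since their squares exceed \<open>2n\<close>, and Chebyshev's bound applies to them.\<close>

lemma central_binomial_upper_bound:
  fixes n t :: nat
  assumes n: "n > 4" and no_prime: "\<And>p. prime p \<Longrightarrow> n < p \<Longrightarrow> p \<le> 2 * n \<Longrightarrow> False"
    and t: "2 * n < (t + 1)\<^sup>2" "t \<ge> 1"
  shows "(2 * n) choose n \<le> (2 * n) ^ (t - 1) * 4 ^ (2 * n div 3)"
proof -
  let ?C = "(2 * n) choose n"
  let ?f = "\<lambda>p. p ^ multiplicity p ?C"
  have C0: "?C \<noteq> 0" by simp
  have pp: "?f p \<le> 2 * n" if "prime p" for p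
    using prime_power_dvd_binomial_le[OF that multiplicity_dvd[of p ?C]] n by simp
  have le: "p \<le> 2 * n div 3" if p: "p \<in> prime_factors ?C" for p
  proof (rule ccontr)
    assume *: "\<not> p \<le> 2 * n div 3"
    have "prime p" "p dvd ?C" using p by auto
    then have "p ^ 1 \<le> 2 * n" using prime_power_dvd_binomial_le[of p 1 "2 * n" n] n by simp
    then have "p \<le> n" using no_prime[of p] \<open>prime p\<close> by force
    moreover have "2 * n < 3 * p" "p > 2" using * n by auto
    ultimately show False using not_dvd_central_binomial \<open>prime p\<close> \<open>p dvd ?C\<close> by blast
  qed
  let ?S = "{p \<in> prime_factors ?C. p \<le> t}" 
  let ?L = "{p \<in> prime_factors ?C. t < p}" 
  have "?C = (\<Prod>p\<in>prime_factors ?C. ?f p)" using prod_prime_factors[OF C0] by simp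
  also have "prime_factors ?C = ?S \<union> ?L" by auto
  also have "prod ?f (?S \<union> ?L) = prod ?f ?S * prod ?f ?L"
    by (rule prod.union_disjoint) auto
  also have "\<dots> \<le> (2 * n) ^ (t - 1) * 4 ^ (2 * n div 3)"
  proof (rule mult_mono)
    have "prod ?f ?S \<le> (\<Prod>p\<in>?S. 2 * n)" by (rule prod_mono) (auto intro: pp)
    also have "\<dots> = (2 * n) ^ card ?S" by simp
    also have "card ?S \<le> card {2..t}" by (rule card_mono) (auto simp: in_prime_factors_iff intro: prime_ge_2_nat)
    then have "(2 * n) ^ card ?S \<le> (2 * n) ^ (t - 1)" using n by (intro power_increasing) auto
    finally show "prod ?f ?S \<le> (2 * n) ^ (t - 1)" .
  next
    have "prod ?f ?L \<le> (\<Prod>p\<in>?L. p)"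
    proof (rule prod_mono, safe)
      fix p assume p: "p \<in> prime_factors ?C" "t < p"
      have "multiplicity p ?C < 2"
      proof (rule ccontr)
        assume "\<not> multiplicity p ?C < 2"
        then have "p ^ 2 \<le> ?f p" using p by (intro power_increasing) (auto dest: in_prime_factors_imp_prime simp: prime_ge_1_nat)
        also have "\<dots> \<le> 2 * n" using p by (intro pp) auto
        finally have "p\<^sup>2 < (t + 1)\<^sup>2" using t(1) by simp
        then have "p < t + 1" by (rule power_less_imp_less_base) simp
        with p show False by simp
      qed
      then have "?f p \<le> p ^ 1" using p by (intro power_increasing) (auto dest: in_prime_factors_imp_prime simp: prime_ge_1_nat)
      then show "?f p \<le> p" by simp
    qed
    also have "\<dots> \<le> \<Prod>{p. prime p \<and> p \<le> 2 * n div 3}"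
    proof (rule dvd_imp_le)
      show "(\<Prod>p\<in>?L. p) dvd \<Prod>{p. prime p \<and> p \<le> 2 * n div 3}"
        by (rule prod_dvd_prod_subset) (auto intro: le)
      show "\<Prod>{p::nat. prime p \<and> p \<le> 2 * n div 3} > 0"
        by (rule prod_pos) (auto intro: prime_gt_0_nat)
    qed
    also have "\<dots> \<le> 4 ^ (2 * n div 3)" by (rule prod_primes_le_4_pow)
    finally show "prod ?f ?L \<le> 4 ^ (2 * n div 3)" .
  qed auto
  finally show ?thesis .
qed

text \<open>With \<open>t\<close> the integer square root of \<open>2n\<close>, comparing the bounds
  on the central binomial coefficient yields \<open>4^n \<le> (2n)^(3t)\<close>, hence
  \<open>2^(t^2) \<le> (t+1)^(6t)\<close>, which fails for \<open>t \<ge> 30\<close>. The threshold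
  450 is \<open>30^2 / 2\<close>.\<close>

lemma ex_prime_between_large:
  fixes n :: nat
  assumes "n \<ge> 450"
  shows "\<exists>p. prime p \<and> n < p \<and> p \<le> 2 * n"
proof (rule ccontr)
  assume contr: "\<not> ?thesis"
  define t where "t = floor_sqrt (2 * n)"
  have t1: "t\<^sup>2 \<le> 2 * n" and t2: "2 * n < (t + 1)\<^sup>2"
    using Suc_floor_sqrt_power2_gt[of "2 * n"] by (auto simp: t_def)
  have t: "t \<ge> 30"
  proof (rule ccontr)
    assume "\<not> t \<ge> 30"
    then have "(t + 1)\<^sup>2 \<le> 30\<^sup>2" by (intro power_mono) auto
    then show False using t2 assms by simp
  qed
  have "4 ^ n \<le> (2 * n) * ((2 * n) choose n)"
  proof -
    have "real (4 ^ n) \<le> real ((2 * n) * ((2 * n) choose n))"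
      using central_binomial_lower_bound[of n] assms by (simp add: field_simps)
    then show ?thesis by (simp only: of_nat_le_iff)
  qed
  also have "\<dots> \<le> (2 * n) * ((2 * n) ^ (t - 1) * 4 ^ (2 * n div 3))"
    using contr assms t t2 by (intro mult_left_mono central_binomial_upper_bound) auto
  also have "\<dots> = (2 * n) ^ t * 4 ^ (2 * n div 3)"
    using t by (cases t) auto
  \<comment> \<open>Cubing removes the division by 3 in the exponent.\<close>
  finally have "(4 ^ n) ^ 3 \<le> ((2 * n) ^ t * 4 ^ (2 * n div 3)) ^ 3" by (intro power_mono) auto
  also have "\<dots> = (2 * n) ^ (3 * t) * 4 ^ (3 * (2 * n div 3))"
    by (simp add: power_mult_distrib power_mult[symmetric] mult.commute)
  also have "\<dots> \<le> (2 * n) ^ (3 * t) * 4 ^ (2 * n)"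
    by (intro mult_left_mono power_increasing) auto
  also have "(4 ^ n) ^ 3 = (4::nat) ^ n * 4 ^ (2 * n)"
    by (simp add: power_mult[symmetric] power_add[symmetric] mult.commute)
  finally have "4 ^ n * 4 ^ (2 * n) \<le> (2 * n) ^ (3 * t) * 4 ^ (2 * n)" .
  then have "4 ^ n \<le> (2 * n) ^ (3 * t)" by simp
  have "2 ^ (t\<^sup>2) \<le> (2::nat) ^ (2 * n)" using t1 by (intro power_increasing) auto
  also have "\<dots> = 4 ^ n" by (simp add: power_mult)
  also have "\<dots> \<le> (2 * n) ^ (3 * t)" by fact
  also have "\<dots> \<le> ((t + 1)\<^sup>2) ^ (3 * t)" using t2 by (intro power_mono) auto
  also have "\<dots> = ((t + 1) ^ 6) ^ t" by (simp add: power_mult[symmetric])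
  also have "\<dots> < (2 ^ t) ^ t"
    using exponential_beats_power_6[OF t] t by (intro power_strict_mono) auto
  also have "\<dots> = 2 ^ (t\<^sup>2)" by (simp add: power_mult[symmetric] power2_eq_square)
  finally show False by simp
qed

lemma Bertrand_postulate:
  fixes n :: nat
  assumes "n \<ge> 1"
  shows "\<exists>p. prime p \<and> n < p \<and> p \<le> 2 * n"
proof (cases "n \<ge> 450")
  case True
  then show ?thesis by (rule ex_prime_between_large)
next
  case False
  show ?thesis
  proof (rule ccontr)
    assume "\<not> ?thesis"
    then have gap: "p \<le> 2 * n \<longrightarrow> p \<le> n" if "prime p" for p using that not_le by blast
    \<comment> \<open>Each prime in this chain is less than twice its predecessor, so
      \<open>gap\<close> pushes \<open>n\<close> past all of them.\<close>
    have "2 \<le> n" using gap[of 2] assms by simp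
    then have "3 \<le> n" using gap[of 3] by simp
    then have "5 \<le> n" using gap[of 5] by simp
    then have "7 \<le> n" using gap[of 7] by simp
    then have "13 \<le> n" using gap[of 13] by simp
    then have "23 \<le> n" using gap[of 23] by simp
    then have "43 \<le> n" using gap[of 43] by simp
    then have "83 \<le> n" using gap[of 83] by simp
    then have "163 \<le> n" using gap[of 163] by simp
    then have "317 \<le> n" using gap[of 317] by simp
    then have "631 \<le> n" using gap[of 631] by simp
    with False show False by simp
  qed
qed

section \<open>Divisibility by the next prime\<close>

lemma of_nat_in_int_adjoin: "real m \<in> int_adjoin \<alpha> \<beta>"
  using of_int_in_int_adjoin[of "int m"] by simp

lemma power_in_int_adjoin: "x \<in> int_adjoin \<alpha> \<beta> \<Longrightarrow> x ^ m \<in> int_adjoin \<alpha> \<beta>"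
  by (induction m) (auto intro: int_adjoin.intros)

lemma prod_in_int_adjoin:
  "(\<And>i. i \<in> A \<Longrightarrow> f i \<in> int_adjoin \<alpha> \<beta>) \<Longrightarrow> prod f A \<in> int_adjoin \<alpha> \<beta>"
  by (induction A rule: infinite_finite_induct) (auto intro: int_adjoin.intros)

text \<open>The recursion has integer coefficients; this puts the cofactor of the prime into the
  ring.\<close>

lemma Psi_in_int_adjoin: "Psi a b n \<in> int_adjoin a b"
proof (induction a b n rule: Psi.induct)
  case (1 a b)
  then show ?case using of_nat_in_int_adjoin[of 2] by simp
next
  case (3 a b n)
  then show ?case
    using of_nat_in_int_adjoin[of 2]
    by (auto intro!: int_adjoin.diff int_adjoin.mult power_in_int_adjoin int_adjoin.gen1 int_adjoin.gen2)
qed (auto intro: int_adjoin.one)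

lemma nth_prime_consecutive:
  assumes "k > 1"
  shows "prime (nth_prime k)" "prime (nth_prime (k + 1))"
    "nth_prime k < nth_prime (k + 1)" "nth_prime (k + 1) < 2 * nth_prime k"
proof -
  let ?P = "{p::nat. prime p}"
  have inf: "infinite ?P" by (rule primes_infinite)
  \<comment> \<open>\<open>nth_prime k\<close> has index \<open>Suc j\<close> in the enumeration
    from 0, so the prime at index \<open>j\<close> lies below it and forces
    \<open>nth_prime k > 2\<close>.\<close>
  obtain j where k: "k = Suc (Suc j)" using assms by (cases k; cases "k - 1") auto
  have p: "nth_prime k = enumerate ?P (Suc j)" and q: "nth_prime (k + 1) = enumerate ?P (Suc (Suc j))"
    by (simp_all add: nth_prime_def k del: enumerate_Suc)
  show p': "prime (nth_prime k)" and "prime (nth_prime (k + 1))"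
    unfolding p q using enumerate_in_set[OF inf] by blast+
  show "nth_prime k < nth_prime (k + 1)" unfolding p q by (rule enumerate_step[OF inf])
  have "prime (enumerate ?P j)" using enumerate_in_set[OF inf] by blast
  then have "2 \<le> enumerate ?P j" by (rule prime_ge_2_nat)
  also have "\<dots> < nth_prime k" unfolding p by (rule enumerate_step[OF inf])
  finally have "2 < nth_prime k" .
  obtain r where r: "prime r" "nth_prime k < r" "r \<le> 2 * nth_prime k"
    using Bertrand_postulate[of "nth_prime k"] p' prime_ge_1_nat by blast
  have "nth_prime (k + 1) \<le> r"
    unfolding q enumerate_Suc''[OF inf, of "Suc j"] using r by (intro Least_le) (simp add: p)
  \<comment> \<open>Strictness: \<open>2 * nth_prime k\<close> is even and greater than 2, hence not
    prime.\<close>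
  moreover have "r \<noteq> 2 * nth_prime k"
    using r(1) \<open>2 < nth_prime k\<close> prime_odd_nat[of r] by auto
  ultimately show "nth_prime (k + 1) < 2 * nth_prime k" using r(3) by linarith
qed

lemma nth_prime_Suc_dvd_Omega:
  assumes "k > 1"
  shows "dvd_in (int_adjoin \<alpha> \<beta>) (real (nth_prime (k + 1)))
    (Omega 0 (nth_prime k) \<alpha> \<beta> (2 * nth_prime k))"
proof -
  define p q where "p = nth_prime k" and "q = nth_prime (k + 1)"
  have pq: "p < q" "q < 2 * p" using nth_prime_consecutive[OF assms] by (simp_all add: p_def q_def)
  let ?f = "\<lambda>i. real (2 * p) - real i"
  \<comment> \<open>The prime \<open>q\<close> is the factor with \<open>i = 2 * p - q\<close>, an
    index in \<open>{1..p}\<close> because \<open>p < q < 2 * p\<close>.\<close>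
  have "prod ?f {1..p} = ?f (2 * p - q) * prod ?f ({1..p} - {2 * p - q})"
    using pq by (intro prod.remove) auto
  also have "?f (2 * p - q) = real q" using pq by (simp add: of_nat_diff)
  finally have "Omega 0 p \<alpha> \<beta> (2 * p) =
      real q * (Psi \<alpha> \<beta> (2 * p) * prod ?f ({1..p} - {2 * p - q}))"
    using Omega_eq_Psi[of "2 * p" \<alpha> \<beta>] pq by simp
  moreover have "Psi \<alpha> \<beta> (2 * p) * prod ?f ({1..p} - {2 * p - q}) \<in> int_adjoin \<alpha> \<beta>"
    by (intro int_adjoin.mult Psi_in_int_adjoin prod_in_int_adjoin int_adjoin.diff of_nat_in_int_adjoin)
  ultimately show ?thesis unfolding dvd_in_def p_def q_def by blast
qed

section \<open>Assembling the four claims\<close>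

text \<open>The condition \<open>r + k \<le> n div 2\<close> makes the sum empty for
  \<open>k > n div 2\<close>, whereas \<open>{..n div 2 - k}\<close> would then still contain
  0.\<close>

lemma dir_op_pow_Psi_expansion:
  assumes "n \<ge> 1"
  shows "(-1) ^ k / fact k * (dir_op \<alpha> \<beta> ^^ k) (\<lambda>a b. Psi a b n) a b =
    (\<Sum>r | r + k \<le> n div 2. Omega_coeff \<alpha> \<beta> n k r * a ^ r * (2 * a - b) ^ (n div 2 - k - r))"
proof (cases "k \<le> n div 2")
  case True
  then have "{r. r + k \<le> n div 2} = {..n div 2 - k}" by auto
  then show ?thesis
    unfolding dir_op_pow_Psi[OF assms True] hom_poly_scale
    by (simp add: hom_poly_def mult.assoc[symmetric] power_mult_distrib[symmetric])
next
  case False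
  then have "{r. r + k \<le> n div 2} = {}" by auto
  then show ?thesis using False dir_op_pow_Psi_eq_0[OF assms, of k] by simp
qed

lemma prod_diff_neq_0:
  assumes "n \<ge> 1"
  shows "(\<Prod>i = 1..n div 2. real n - real i) \<noteq> 0"
  using assms by auto

theorem theorem10:
  shows
    "(\<forall>(n::nat) \<zeta> \<xi>. n \<ge> 1 \<longrightarrow> (\<zeta>, \<xi>) \<noteq> (0, 0) \<longrightarrow>
        Psi \<zeta> \<xi> n = Omega 0 (n div 2) \<zeta> \<xi> n / (\<Prod>i = 1..n div 2. real n - real i))
   \<and> (\<forall>(n::nat) (x::real) (y::real). n \<ge> 1 \<longrightarrow> (x + y) ^ delta n \<noteq> 0 \<longrightarrow>
        (x ^ n + y ^ n) / (x + y) ^ delta n =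
          Omega 0 (n div 2) (x * y) (- x\<^sup>2 - y\<^sup>2) n / (\<Prod>i = 1..n div 2. real n - real i))
   \<and> (\<forall>(n::nat) (k::nat) \<alpha> \<beta> a b. n \<ge> 1 \<longrightarrow> (\<alpha>, \<beta>) \<noteq> (0, 0) \<longrightarrow>
        (- 1) ^ k / fact k * (dir_op \<alpha> \<beta> ^^ k) (\<lambda>a b. Psi a b n) a b =
          (\<Sum>r | r + k \<le> n div 2.
             (- 1) ^ (r + k) * (fact (n - r - k - 1) * real n / (fact (n - 2 * r) * fact r))
             * real ((n div 2 - r) choose k) * Omega r k \<alpha> \<beta> n
             * a ^ r * (2 * a - b) ^ (n div 2 - k - r)))
   \<and> (\<forall>(k::nat) \<alpha> \<beta>. k > 1 \<longrightarrow> (\<alpha>, \<beta>) \<noteq> (0, 0) \<longrightarrow>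
        dvd_in (int_adjoin \<alpha> \<beta>) (real (nth_prime (k + 1)))
          (Omega 0 (nth_prime k) \<alpha> \<beta> (2 * nth_prime k)))"
proof (intro conjI allI impI)
  fix n :: nat and \<zeta> \<xi> :: real
  assume "n \<ge> 1"
  then show "Psi \<zeta> \<xi> n = Omega 0 (n div 2) \<zeta> \<xi> n / (\<Prod>i = 1..n div 2. real n - real i)"
    unfolding Omega_eq_Psi[OF \<open>n \<ge> 1\<close>] using prod_diff_neq_0 by simp
next
  fix n :: nat and x y :: real
  assume n: "n \<ge> 1" and "(x + y) ^ delta n \<noteq> 0"
  then show "(x ^ n + y ^ n) / (x + y) ^ delta n =
      Omega 0 (n div 2) (x * y) (- x\<^sup>2 - y\<^sup>2) n / (\<Prod>i = 1..n div 2. real n - real i)"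
    unfolding Omega_eq_Psi[OF n] Psi_power_sum[symmetric] using prod_diff_neq_0[OF n] by simp
next
  fix n k :: nat and \<alpha> \<beta> a b :: real
  assume "n \<ge> 1"
  show "(- 1) ^ k / fact k * (dir_op \<alpha> \<beta> ^^ k) (\<lambda>a b. Psi a b n) a b =
          (\<Sum>r | r + k \<le> n div 2.
             (- 1) ^ (r + k) * (fact (n - r - k - 1) * real n / (fact (n - 2 * r) * fact r))
             * real ((n div 2 - r) choose k) * Omega r k \<alpha> \<beta> n
             * a ^ r * (2 * a - b) ^ (n div 2 - k - r))"
    unfolding dir_op_pow_Psi_expansion[OF \<open>n \<ge> 1\<close>] Omega_coeff_def ..
next
  fix k :: nat and \<alpha> \<beta> :: real
  assume "k > 1"
  then show "dvd_in (int_adjoin \<alpha> \<beta>) (real (nth_prime (k + 1)))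
      (Omega 0 (nth_prime k) \<alpha> \<beta> (2 * nth_prime k))"
    by (rule nth_prime_Suc_dvd_Omega)
qed

end
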